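(* Let $C$ be a closed normal cone with nonempty interior $C^\circ$ in a real Banach space $X$. If $f\colon C^\circ\to C^\circ$ is an order-preserving homogeneous mapping and $f$ has converging approximate eigenvectors, then $$\rho(f)=\max_{h\in\mathcal{A}_R}\ \inf_{x\in C^\circ}\bigl(h(x)-h(f(x))\bigr),$$ where $\mathcal{A}_R$ consists of those $h\in\overline{i_R(C^\circ)}$ for which there exists a net $(y_\alpha)$ in $C^\circ$, with $y_\alpha\to y\in C$ in norm and $\|y\|_b=1$, such that $i_R(y_\alpha)\to h$ in $\mathcal{C}(C^\circ)$. If $f$ has no eigenvector in $C^\circ$, then the maximum is attained at some $h\in\mathcal{A}_R\cap\mathcal{H}_R$.
   Context: A cone $C\subseteq X$ is a convex set with $C\cap(-C)=\{0\}$ and $\lambda C\subseteq C$ for all $\lambda\ge0$; $x\le_C y$ means $y-x\in C$. $C$ is normal if there is $\kappa\ge0$ with $\|x\|\le\kappa\|y\|$ whenever $0\le_C x\le_C y$. $f$ is order-preserving if $x\le_C y$ implies $f(x)\le_C f(y)$, and homogeneous if $f(\lambda x)=\lambda f(x)$ for $\lambda>0$. For $x\in X$, $y\in C^\circ$, $M(x/y)=\inf\{\beta\in\mathbb{R}\colon x\le_C\beta y\}$. For $x,y\in C^\circ$, $\mathrm{RFunk}_C(x,y)=\log M(y/x)$ and $d_C(x,y)=\log\max\{M(x/y),M(y/x)\}$. The linear escape rate of $f$ is $\rho(f)=\lim_{k\to\infty}\frac{\mathrm{RFunk}_C(x,f^k(x))}{k}$, where $x\in C^\circ$ (the limit exists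 and is independent of $x$). $\mathcal{C}(C^\circ)$ is the space of continuous functions $(C^\circ,d_C)\to\mathbb{R}$ with the topology of uniform convergence on compact sets. Fix a base point $b\in C^\circ$, let $\|x\|_b=\inf\{\lambda\ge0\colon-\lambda b\le_C x\le_C\lambda b\}$, and define $i_R\colon C^\circ\to\mathcal{C}(C^\circ)$ by $i_R(y)(x)=\mathrm{RFunk}_C(x,y)-\mathrm{RFunk}_C(b,y)$. $\overline{i_R(C^\circ)}$ is the closure in $\mathcal{C}(C^\circ)$ and $\mathcal{H}_R=\overline{i_R(C^\circ)}\setminus i_R(C^\circ)$. Approximate eigenvectors: fix a norm $|\cdot|$ on $X$ equivalent to $\|\cdot\|$ which is monotone ($|x|\le|y|$ whenever $0\le_C x\le_C y$), and fix $u\in C^\circ$ with $\|u\|=1$. For $\epsilon>0$ the map $f_{\epsilon,u}(x)=f(x)+\epsilon|x|u$ on $C^\circ$ has a unique eigenvector $v_{\epsilon,u}\in C^\circ$ with $|v_{\epsilon,u}|=1$. We say that $f$ has converging approximate eigenvectors if there is a sequence $\epsilon_n\to0^+$ such that $(v_{\epsilon_n,u})_n$ converges in the norm topology. *)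

theory Defs
  imports "HOL-Analysis.Analysis"
begin

text \<open>The constant \<^const>\<open>cone\<close> only expresses closure under multiplication with scalars
  \<open>c \<ge> 0\<close>.\<close>

definition pointed_convex_cone :: "'a::real_vector set \<Rightarrow> bool" where
  "pointed_convex_cone C \<longleftrightarrow> convex C \<and> cone C \<and> C \<inter> uminus ` C = {0}"

definition cone_le :: "'a::real_vector set \<Rightarrow> 'a \<Rightarrow> 'a \<Rightarrow> bool" where
  "cone_le C x y \<longleftrightarrow> y - x \<in> C"

definition normal_cone :: "'a::real_normed_vector set \<Rightarrow> bool" where
  "normal_cone C \<longleftrightarrow>
    (\<exists>\<kappa>\<ge>0. \<forall>x y. cone_le C 0 x \<and> cone_le C x y \<longrightarrow> norm x \<le> \<kappa> * norm y)"

definition order_preserving_on :: "'a::real_vector set \<Rightarrow> 'a set \<Rightarrow> ('a \<Rightarrow> 'a) \<Rightarrow> bool" where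
  "order_preserving_on C D f \<longleftrightarrow> (\<forall>x\<in>D. \<forall>y\<in>D. cone_le C x y \<longrightarrow> cone_le C (f x) (f y))"

definition homogeneous_on :: "'a::real_vector set \<Rightarrow> ('a \<Rightarrow> 'a) \<Rightarrow> bool" where
  "homogeneous_on D f \<longleftrightarrow> (\<forall>x\<in>D. \<forall>r>0. f (r *\<^sub>R x) = r *\<^sub>R f x)"

definition M_fun :: "'a::real_vector set \<Rightarrow> 'a \<Rightarrow> 'a \<Rightarrow> real" where
  "M_fun C x y = Inf {\<beta>. cone_le C x (\<beta> *\<^sub>R y)}"

definition RFunk :: "'a::real_vector set \<Rightarrow> 'a \<Rightarrow> 'a \<Rightarrow> real" where
  "RFunk C x y = ln (M_fun C y x)"

text \<open>Thompson's metric on the interior of the cone. The value 0 elsewhere is a dummy: the locale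
  \<^locale>\<open>Metric_space\<close> requires nonnegativity also outside of the carrier.\<close>

definition thompson_dist :: "'a::real_normed_vector set \<Rightarrow> 'a \<Rightarrow> 'a \<Rightarrow> real" where
  "thompson_dist C x y =
    (if x \<in> interior C \<and> y \<in> interior C then ln (max (M_fun C x y) (M_fun C y x)) else 0)"

definition thompson_topology :: "'a::real_normed_vector set \<Rightarrow> 'a topology" where
  "thompson_topology C = Metric_space.mtopology (interior C) (thompson_dist C)"

definition escape_rate :: "'a::real_normed_vector set \<Rightarrow> ('a \<Rightarrow> 'a) \<Rightarrow> real" where
  "escape_rate C f =
    (THE r. \<forall>x\<in>interior C. (\<lambda>k. RFunk C x ((f ^^ k) x) / real k) \<longlonglongrightarrow> r)"

text \<open>Functions on a topological space are represented by total functions that are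
  \<^const>\<open>undefined\<close> off the space, so that equality means equality on the space.\<close>

definition continuous_functions :: "'a topology \<Rightarrow> ('a \<Rightarrow> real) set" where
  "continuous_functions T =
    {h \<in> extensional (topspace T). continuous_map T euclideanreal h}"

definition compact_convergence :: "'a topology \<Rightarrow> ('a \<Rightarrow> real) topology" where
  "compact_convergence T = topology (\<lambda>U. U \<subseteq> continuous_functions T \<and>
     (\<forall>h\<in>U. \<exists>K \<epsilon>. compactin T K \<and> \<epsilon> > 0 \<and>
        {g \<in> continuous_functions T. \<forall>x\<in>K. \<bar>g x - h x\<bar> < \<epsilon>} \<subseteq> U))"

definition order_unit_norm :: "'a::real_vector set \<Rightarrow> 'a \<Rightarrow> 'a \<Rightarrow> real" where
  "order_unit_norm C b x =
    Inf {r. r \<ge> 0 \<and> cone_le C (- (r *\<^sub>R b)) x \<and> cone_le C x (r *\<^sub>R b)}"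

definition i_R :: "'a::real_normed_vector set \<Rightarrow> 'a \<Rightarrow> 'a \<Rightarrow> 'a \<Rightarrow> real" where
  "i_R C b y = restrict (\<lambda>x. RFunk C x y - RFunk C b y) (interior C)"

definition RFunk_closure :: "'a::real_normed_vector set \<Rightarrow> 'a \<Rightarrow> ('a \<Rightarrow> real) set" where
  "RFunk_closure C b = compact_convergence (thompson_topology C) closure_of (i_R C b ` interior C)"

definition horofunctions_R :: "'a::real_normed_vector set \<Rightarrow> 'a \<Rightarrow> ('a \<Rightarrow> real) set" where
  "horofunctions_R C b = RFunk_closure C b - i_R C b ` interior C"

text \<open>A net \<open>(y\<^sub>\<alpha>)\<close> in the interior of \<open>C\<close> is represented by the filter generated by its tails,
  i.e. by a proper filter \<open>F\<close> on the ambient space that contains the interior of \<open>C\<close>; conversely,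
  every such filter is the tail filter of the net of pairs \<open>(S, z)\<close> with \<open>z \<in> S \<in> F\<close>. Convergence
  of \<open>g(y\<^sub>\<alpha>)\<close> is convergence of \<open>g\<close> along \<open>F\<close>.\<close>

definition A_R :: "'a::real_normed_vector set \<Rightarrow> 'a \<Rightarrow> ('a \<Rightarrow> real) set" where
  "A_R C b = {h \<in> RFunk_closure C b. \<exists>F y. F \<noteq> bot \<and> eventually (\<lambda>z. z \<in> interior C) F \<and>
     y \<in> C \<and> ((\<lambda>z. z) \<longlongrightarrow> y) F \<and> order_unit_norm C b y = 1 \<and>
     limitin (compact_convergence (thompson_topology C)) (i_R C b) h F}"

definition equivalent_norm :: "('a::real_normed_vector \<Rightarrow> real) \<Rightarrow> bool" where
  "equivalent_norm p \<longleftrightarrow>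
    (\<forall>x. p x = 0 \<longleftrightarrow> x = 0) \<and> (\<forall>x y. p (x + y) \<le> p x + p y) \<and> (\<forall>r x. p (r *\<^sub>R x) = \<bar>r\<bar> * p x) \<and>
    (\<exists>c>0. \<exists>d>0. \<forall>x. c * norm x \<le> p x \<and> p x \<le> d * norm x)"

definition monotone_norm :: "'a::real_vector set \<Rightarrow> ('a \<Rightarrow> real) \<Rightarrow> bool" where
  "monotone_norm C p \<longleftrightarrow> (\<forall>x y. cone_le C 0 x \<and> cone_le C x y \<longrightarrow> p x \<le> p y)"

definition f_approx :: "('a::real_vector \<Rightarrow> 'a) \<Rightarrow> ('a \<Rightarrow> real) \<Rightarrow> 'a \<Rightarrow> real \<Rightarrow> 'a \<Rightarrow> 'a" where
  "f_approx f p u \<epsilon> x = f x + (\<epsilon> * p x) *\<^sub>R u"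

definition is_eigenvector_in :: "'a::real_vector set \<Rightarrow> ('a \<Rightarrow> 'a) \<Rightarrow> 'a \<Rightarrow> bool" where
  "is_eigenvector_in D f v \<longleftrightarrow> v \<in> D \<and> v \<noteq> 0 \<and> (\<exists>r::real. f v = r *\<^sub>R v)"

text \<open>The normalised eigenvector of \<^term>\<open>f_approx f p u \<epsilon>\<close> exists and is unique for \<open>\<epsilon> > 0\<close>, so
  the sequence \<open>v\<close> below is determined by the sequence \<open>\<epsilon>\<close>.\<close>

definition converging_approx_eigenvectors ::
    "'a::real_normed_vector set \<Rightarrow> ('a \<Rightarrow> 'a) \<Rightarrow> ('a \<Rightarrow> real) \<Rightarrow> 'a \<Rightarrow> bool" where
  "converging_approx_eigenvectors C f p u \<longleftrightarrow>
    (\<exists>(\<epsilon> :: nat \<Rightarrow> real) v. (\<forall>n. \<epsilon> n > 0) \<and> \<epsilon> \<longlonglongrightarrow> 0 \<and>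
       (\<forall>n. is_eigenvector_in (interior C) (f_approx f p u (\<epsilon> n)) (v n) \<and> p (v n) = 1) \<and>
       convergent v)"


subsection \<open>Well-definedness of the topologies\<close>

lemma istopology_compact_convergence:
  "istopology (\<lambda>U. U \<subseteq> continuous_functions T \<and>
     (\<forall>h\<in>U. \<exists>K \<epsilon>. compactin T K \<and> \<epsilon> > (0::real) \<and>
        {g \<in> continuous_functions T. \<forall>x\<in>K. \<bar>g x - h x\<bar> < \<epsilon>} \<subseteq> U))"
  (is "istopology ?P")
  unfolding istopology_def
proof (intro conjI allI impI)
  fix S U assume S: "?P S" and U: "?P U"
  show "S \<inter> U \<subseteq> continuous_functions T" using S by blast
  show "\<forall>h\<in>S \<inter> U. \<exists>K \<epsilon>. compactin T K \<and> \<epsilon> > (0::real) \<and>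
        {g \<in> continuous_functions T. \<forall>x\<in>K. \<bar>g x - h x\<bar> < \<epsilon>} \<subseteq> S \<inter> U"
  proof
    fix h assume h: "h \<in> S \<inter> U"
    obtain K d where K: "compactin T K" "d > (0::real)"
        "{g \<in> continuous_functions T. \<forall>x\<in>K. \<bar>g x - h x\<bar> < d} \<subseteq> S"
      using S h by blast
    obtain L e where L: "compactin T L" "e > (0::real)"
        "{g \<in> continuous_functions T. \<forall>x\<in>L. \<bar>g x - h x\<bar> < e} \<subseteq> U"
      using U h by blast
    have "{g \<in> continuous_functions T. \<forall>x\<in>K \<union> L. \<bar>g x - h x\<bar> < min d e} \<subseteq> S \<inter> U"
      using K(3) L(3) by auto
    moreover have "compactin T (K \<union> L)" "min d e > 0"
      using K L by (auto intro: compactin_Un)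
    ultimately show "\<exists>K \<epsilon>. compactin T K \<and> \<epsilon> > (0::real) \<and>
        {g \<in> continuous_functions T. \<forall>x\<in>K. \<bar>g x - h x\<bar> < \<epsilon>} \<subseteq> S \<inter> U" by blast
  qed
next
  fix \<K> assume K: "\<forall>S\<in>\<K>. ?P S"
  show "\<Union>\<K> \<subseteq> continuous_functions T" using K by blast
  show "\<forall>h\<in>\<Union>\<K>. \<exists>K \<epsilon>. compactin T K \<and> \<epsilon> > (0::real) \<and>
        {g \<in> continuous_functions T. \<forall>x\<in>K. \<bar>g x - h x\<bar> < \<epsilon>} \<subseteq> \<Union>\<K>"
  proof
    fix h assume "h \<in> \<Union>\<K>"
    then obtain S where S: "S \<in> \<K>" "h \<in> S" by blast
    then obtain L e where "compactin T L" "e > (0::real)"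
        "{g \<in> continuous_functions T. \<forall>x\<in>L. \<bar>g x - h x\<bar> < e} \<subseteq> S"
      using K by blast
    then show "\<exists>K \<epsilon>. compactin T K \<and> \<epsilon> > (0::real) \<and>
        {g \<in> continuous_functions T. \<forall>x\<in>K. \<bar>g x - h x\<bar> < \<epsilon>} \<subseteq> \<Union>\<K>"
      using S by blast
  qed
qed

lemma openin_compact_convergence:
  "openin (compact_convergence T) U \<longleftrightarrow> U \<subseteq> continuous_functions T \<and>
     (\<forall>h\<in>U. \<exists>K \<epsilon>. compactin T K \<and> \<epsilon> > 0 \<and>
        {g \<in> continuous_functions T. \<forall>x\<in>K. \<bar>g x - h x\<bar> < \<epsilon>} \<subseteq> U)"
  unfolding compact_convergence_def topology_inverse'[OF istopology_compact_convergence] ..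

lemma topspace_compact_convergence: "topspace (compact_convergence T) = continuous_functions T"
proof
  show "topspace (compact_convergence T) \<subseteq> continuous_functions T"
    using openin_topspace openin_compact_convergence by blast
  have "compactin T {}" "(1::real) > 0" by simp_all
  then have "openin (compact_convergence T) (continuous_functions T)"
    unfolding openin_compact_convergence by blast
  then show "continuous_functions T \<subseteq> topspace (compact_convergence T)"
    by (rule openin_subset)
qed

context
  fixes C :: "'a::real_normed_vector set"
  assumes C: "pointed_convex_cone C" "closed C" and zero: "0 \<notin> interior C"
begin

lemma cone_add: "x \<in> C \<Longrightarrow> y \<in> C \<Longrightarrow> x + y \<in> C"
proof -
  assume xy: "x \<in> C" "y \<in> C"
  have "convex C" "cone C" using C(1) unfolding pointed_convex_cone_def by simp_all
  then show ?thesis using xy convex_cone[of C] by simp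
qed

lemma cone_scale: "x \<in> C \<Longrightarrow> r \<ge> 0 \<Longrightarrow> r *\<^sub>R x \<in> C"
  using C(1) unfolding pointed_convex_cone_def by (meson mem_cone)

lemma cone_antisym: "x \<in> C \<Longrightarrow> - x \<in> C \<Longrightarrow> x = 0"
proof -
  assume "x \<in> C" "- x \<in> C"
  then have "x \<in> C \<inter> uminus ` C" by (auto intro: image_eqI[of _ _ "- x"])
  then show ?thesis using C(1) unfolding pointed_convex_cone_def by blast
qed

lemma M_fun_nonempty:
  assumes "y \<in> interior C"
  shows "\<exists>\<beta>. cone_le C x (\<beta> *\<^sub>R y)"
proof -
  obtain e where e: "e > 0" "cball y e \<subseteq> C"
    using assms mem_interior_cball by blast
  define t where "t = e / (norm x + 1)"
  have t: "t > 0" unfolding t_def using e by (simp add: add_nonneg_pos)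
  have "t * norm x \<le> t * (norm x + 1)" using t by simp
  also have "\<dots> = e" using norm_ge_zero[of x] unfolding t_def by (simp add: add_nonneg_eq_0_iff)
  finally have "norm (t *\<^sub>R x) \<le> e" using t by simp
  then have "y - t *\<^sub>R x \<in> C"
    using e(2) by (auto simp: subset_iff dist_norm)
  then have "(1 / t) *\<^sub>R (y - t *\<^sub>R x) \<in> C"
    using t by (intro cone_scale) auto
  then show ?thesis
    unfolding cone_le_def using t by (intro exI[of _ "1 / t"]) (simp add: algebra_simps)
qed

lemma M_fun_bdd_below:
  assumes "y \<in> interior C"
  shows "bdd_below {\<beta>. cone_le C x (\<beta> *\<^sub>R y)}"
proof -
  obtain \<gamma> where \<gamma>: "cone_le C (- x) (\<gamma> *\<^sub>R y)" using M_fun_nonempty assms by blast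
  have y: "y \<in> C" "y \<noteq> 0" using assms interior_subset zero by blast+
  have "- \<gamma> \<le> \<beta>" if "cone_le C x (\<beta> *\<^sub>R y)" for \<beta>
  proof (rule ccontr)
    assume "\<not> - \<gamma> \<le> \<beta>"
    then have neg: "\<beta> + \<gamma> < 0" by simp
    have "(\<beta> + \<gamma>) *\<^sub>R y \<in> C"
      using cone_add[OF that[unfolded cone_le_def] \<gamma>[unfolded cone_le_def]]
      by (simp add: algebra_simps)
    then have "(- 1 / (\<beta> + \<gamma>)) *\<^sub>R ((\<beta> + \<gamma>) *\<^sub>R y) \<in> C"
      by (rule cone_scale) (use neg in \<open>simp add: divide_nonpos_neg\<close>)
    moreover have "(- 1 / (\<beta> + \<gamma>)) *\<^sub>R ((\<beta> + \<gamma>) *\<^sub>R y) = - y"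
      using neg by (simp only: scaleR_scaleR) simp
    ultimately have "- y \<in> C" by simp
    then show False using cone_antisym y by blast
  qed
  then show ?thesis by (intro bdd_belowI[of _ "- \<gamma>"]) auto
qed

lemma M_fun_attained:
  assumes "y \<in> interior C"
  shows "cone_le C x (M_fun C x y *\<^sub>R y)"
proof -
  let ?S = "{\<beta>. cone_le C x (\<beta> *\<^sub>R y)}"
  have "?S = (\<lambda>\<beta>. \<beta> *\<^sub>R y - x) -` C" unfolding cone_le_def by auto
  moreover have "closed ((\<lambda>\<beta>. \<beta> *\<^sub>R y - x) -` C)"
    by (intro closed_vimage C(2) continuous_intros)
  ultimately have "closed ?S" by simp
  then have "Inf ?S \<in> ?S"
    using M_fun_nonempty[OF assms, of x] M_fun_bdd_below[OF assms, of x]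
    by (intro closed_contains_Inf) auto
  then show ?thesis unfolding M_fun_def by simp
qed

lemma M_fun_le:
  assumes "y \<in> interior C" "cone_le C x (\<beta> *\<^sub>R y)"
  shows "M_fun C x y \<le> \<beta>"
  unfolding M_fun_def using assms M_fun_bdd_below[OF assms(1)] by (intro cInf_lower) auto

lemma M_fun_pos:
  assumes "x \<in> interior C" "y \<in> interior C"
  shows "M_fun C x y > 0"
proof (rule ccontr)
  assume "\<not> M_fun C x y > 0"
  then have "(- M_fun C x y) *\<^sub>R y \<in> C"
    using assms interior_subset by (intro cone_scale) auto
  from cone_add[OF this M_fun_attained[OF assms(2), of x, unfolded cone_le_def]]
  have "- x \<in> C" by simp
  then show False using cone_antisym[of x] assms(1) interior_subset zero by blast
qed

lemma M_fun_mult: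
  assumes "x \<in> interior C" "y \<in> interior C" "z \<in> interior C"
  shows "M_fun C x z \<le> M_fun C x y * M_fun C y z"
proof (rule M_fun_le)
  have "M_fun C x y *\<^sub>R (M_fun C y z *\<^sub>R z - y) \<in> C"
    using M_fun_attained[OF assms(3), of y] M_fun_pos[OF assms(1,2)]
    unfolding cone_le_def by (intro cone_scale) auto
  from cone_add[OF this M_fun_attained[OF assms(2), of x, unfolded cone_le_def]]
  show "cone_le C x ((M_fun C x y * M_fun C y z) *\<^sub>R z)"
    unfolding cone_le_def by (simp add: algebra_simps)
qed fact

lemma M_fun_self:
  assumes "x \<in> interior C"
  shows "M_fun C x x = 1"
proof (rule antisym)
  have "(0::'a) \<in> C" using cone_scale[of x 0] assms interior_subset by auto
  then show "M_fun C x x \<le> 1" using assms by (intro M_fun_le) (auto simp: cone_le_def)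
  have "M_fun C x x * 1 \<le> M_fun C x x * M_fun C x x" using M_fun_mult[OF assms assms assms] by simp
  then show "1 \<le> M_fun C x x" using M_fun_pos[OF assms assms] by (simp add: mult_le_cancel_left)
qed

lemma M_fun_max_ge_1:
  assumes "x \<in> interior C" "y \<in> interior C"
  shows "max (M_fun C x y) (M_fun C y x) \<ge> 1"
proof (rule ccontr)
  assume "\<not> ?thesis"
  then have "M_fun C x y * M_fun C y x < 1 * 1"
    using M_fun_pos[OF assms] M_fun_pos[OF assms(2,1)] by (intro mult_strict_mono) auto
  then show False
    using M_fun_mult[OF assms assms(1)] M_fun_self[OF assms(1)] by simp
qed

lemma Metric_space_thompson: "Metric_space (interior C) (thompson_dist C)"
proof
  fix x y
  show "0 \<le> thompson_dist C x y"
    unfolding thompson_dist_def using M_fun_max_ge_1 by (auto intro: ln_ge_zero)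
  show "thompson_dist C x y = thompson_dist C y x"
    unfolding thompson_dist_def by (simp add: max.commute conj_commute)
  assume x: "x \<in> interior C" and y: "y \<in> interior C"
  show "thompson_dist C x y = 0 \<longleftrightarrow> x = y"
  proof
    assume "thompson_dist C x y = 0"
    then have "max (M_fun C x y) (M_fun C y x) = 1"
      unfolding thompson_dist_def using x y M_fun_max_ge_1[OF x y]
      by (smt (verit) ln_eq_zero_iff)
    then have M: "M_fun C x y \<le> 1" "M_fun C y x \<le> 1" by linarith+
    have le: "w - v \<in> C" if "v \<in> interior C" "w \<in> interior C" "M_fun C v w \<le> 1" for v w
    proof -
      have "(1 - M_fun C v w) *\<^sub>R w \<in> C" using that interior_subset by (intro cone_scale) auto
      from cone_add[OF this M_fun_attained[OF that(2), of v, unfolded cone_le_def]]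
      show ?thesis by (simp add: algebra_simps)
    qed
    show "x = y" using cone_antisym[of "x - y"] le[OF x y M(1)] le[OF y x M(2)] by simp
  next
    assume "x = y"
    then show "thompson_dist C x y = 0"
      unfolding thompson_dist_def using M_fun_self x by simp
  qed
  fix z assume z: "z \<in> interior C"
  let ?d = "\<lambda>x y. max (M_fun C x y) (M_fun C y x)"
  note p = M_fun_pos[OF x y] M_fun_pos[OF y x] M_fun_pos[OF y z] M_fun_pos[OF z y]
  have "M_fun C x y * M_fun C y z \<le> ?d x y * ?d y z" "M_fun C z y * M_fun C y x \<le> ?d y z * ?d x y"
    using p by (intro mult_mono; simp)+
  then have "?d x z \<le> ?d x y * ?d y z"
    using M_fun_mult[OF x y z] M_fun_mult[OF z y x] by (simp add: mult.commute)
  moreover have "?d x z > 0" "?d x y > 0" "?d y z > 0"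
    using M_fun_max_ge_1[OF x z] M_fun_max_ge_1[OF x y] M_fun_max_ge_1[OF y z] by linarith+
  ultimately have "ln (?d x z) \<le> ln (?d x y) + ln (?d y z)"
    by (metis ln_le_cancel_iff ln_mult_pos mult_pos_pos)
  then show "thompson_dist C x z \<le> thompson_dist C x y + thompson_dist C y z"
    unfolding thompson_dist_def using x y z by simp
qed

end

end

theory Submission
  imports Defs
begin

text \<open>Write \<open>M\<close> for the gauge \<open>M(x/y)\<close>, so that \<open>RFunk(x, y) = ln M(y/x)\<close>, and \<open>\<preceq>\<close> for the order
  of the cone.

  \<^emph>\<open>Upper bound.\<close> Submultiplicativity of \<open>M\<close> gives \<open>h x - h y \<le> RFunk(x, y)\<close> for \<open>h = i_R(z)\<close>, and
  this passes to the closure (\<open>RFunk_closure_diff_le\<close>). If \<open>h x - h (f x) \<ge> s\<close> for all \<open>x\<close>, then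
  summation along an orbit gives \<open>k s \<le> RFunk(x, f^k x)\<close>, so \<open>s\<close> is at most the escape rate
  (\<open>INF_le_escape_rate\<close>).

  \<^emph>\<open>Attainment.\<close> Let \<open>f v\<^sub>n + \<epsilon>\<^sub>n u = r\<^sub>n v\<^sub>n\<close> with \<open>p(v\<^sub>n) = 1\<close> and \<open>v\<^sub>n \<longlonglongrightarrow> w\<close>. The eigenvalues
  lie in a compact interval of positive numbers, so \<open>r\<^sub>n \<longlonglongrightarrow> \<rho> > 0\<close> along a subsequence. Applying the
  perturbed map to \<open>v\<^sub>n \<preceq> M(v\<^sub>n/x) x\<close> gives
  \<open>r\<^sub>n v\<^sub>n \<preceq> M(v\<^sub>n/x) (f x + \<epsilon>\<^sub>n p(x) u)\<close>. Since \<open>M(\<cdot>/x)\<close> is Lipschitz for the norm,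
  the limit is \<open>\<rho> w \<preceq> M(w/x) f x\<close> (\<open>limit_le\<close>). Hence the function
  \<open>h x = RFunk(x, w) - RFunk(b, w)\<close>, which makes sense for every nonzero point \<open>w\<close> of the cone,
  satisfies \<open>h x - h (f x) \<ge> ln \<rho>\<close>; it belongs to \<open>\<A>\<^sub>R\<close> because \<open>i_R\<close>, so extended to the nonzero
  points of the cone, is continuous from the norm to uniform convergence on compact sets
  (\<open>limitin_i_R\<close>). The same inequality and \<open>f^k v\<^sub>n \<preceq> r\<^sub>n^k v\<^sub>n\<close> squeeze \<open>RFunk(x, f^k x) / k\<close>, so the
  escape rate exists and equals \<open>ln \<rho>\<close> (\<open>RFunk_rate\<close>), with no separate subadditivity argument.

  \<^emph>\<open>Horofunctions.\<close> If \<open>h = i_R(y)\<close> with \<open>y\<close> interior, then a positive multiple of \<open>y\<close> lies below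
  \<open>w\<close> (\<open>i_R_eq_imp_interior\<close>), so \<open>w\<close> is interior, and there the limit of the approximate
  eigenvector equations is \<open>f w = \<rho> w\<close> (\<open>interior_limit_eigenvector\<close>). Without an eigenvector in
  the interior, \<open>h\<close> is therefore a horofunction.\<close>

section \<open>The order and the gauge function of a closed cone\<close>

text \<open>The interior may be empty here; \<open>0 \<notin> interior C\<close> excludes the degenerate case \<open>C = UNIV = {0}\<close>.\<close>

locale closed_pointed_cone =
  fixes C :: "'a::real_normed_vector set"
  assumes C: "pointed_convex_cone C" "closed C" and zero: "0 \<notin> interior C"
begin

abbreviation le :: "'a \<Rightarrow> 'a \<Rightarrow> bool" (infix "\<preceq>" 50) where "x \<preceq> y \<equiv> cone_le C x y"

abbreviation M :: "'a \<Rightarrow> 'a \<Rightarrow> real" where "M \<equiv> M_fun C"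

lemmas add_mem = cone_add[OF C zero]
  and scale_mem = cone_scale[OF C zero]
  and antisym_mem = cone_antisym[OF C zero]
  and M_attained = M_fun_attained[OF C zero]
  and M_le = M_fun_le[OF C zero]
  and M_pos_interior = M_fun_pos[OF C zero]
  and M_self = M_fun_self[OF C zero]
  and Metric_space_interior = Metric_space_thompson[OF C zero]

lemma interior_mem: "x \<in> interior C \<Longrightarrow> x \<in> C"
  using interior_subset by blast

lemma interior_nonzero: "x \<in> interior C \<Longrightarrow> x \<in> C - {0}"
  using interior_mem zero by blast

lemma le_trans: "x \<preceq> y \<Longrightarrow> y \<preceq> z \<Longrightarrow> x \<preceq> z"
  unfolding cone_le_def using add_mem[of "y - x" "z - y"] by simp

lemma le_add: "x \<preceq> y \<Longrightarrow> z \<preceq> w \<Longrightarrow> x + z \<preceq> y + w"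
  unfolding cone_le_def using add_mem[of "y - x" "w - z"] by (simp add: algebra_simps)

lemma le_scale: "x \<preceq> y \<Longrightarrow> r \<ge> 0 \<Longrightarrow> r *\<^sub>R x \<preceq> r *\<^sub>R y"
  unfolding cone_le_def using scale_mem[of "y - x" r] by (simp add: algebra_simps)

lemma le_antisym: "x \<preceq> y \<Longrightarrow> y \<preceq> x \<Longrightarrow> x = y"
  unfolding cone_le_def using antisym_mem[of "y - x"] by simp

lemma le_scale_mono: "x \<in> C \<Longrightarrow> r \<le> s \<Longrightarrow> r *\<^sub>R x \<preceq> s *\<^sub>R x"
  unfolding cone_le_def using scale_mem[of x "s - r"] by (simp add: algebra_simps)

lemma le_limit:
  assumes "(g \<longlongrightarrow> x) F" "(k \<longlongrightarrow> y) F" "eventually (\<lambda>n. g n \<preceq> k n) F" "F \<noteq> bot"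
  shows "x \<preceq> y"
proof -
  have "((\<lambda>n. k n - g n) \<longlongrightarrow> y - x) F" by (intro tendsto_diff assms)
  then show ?thesis
    unfolding cone_le_def
    using Lim_in_closed_set[OF C(2) _ assms(4)] assms(3) by (simp add: cone_le_def)
qed

lemma interior_add:
  assumes "x \<in> interior C" "y \<in> C"
  shows "x + y \<in> interior C"
proof -
  have "(+) y ` interior C \<subseteq> C" using add_mem assms(2) interior_mem by blast
  then have "(+) y ` interior C \<subseteq> interior C"
    by (intro interior_maximal open_translation open_interior)
  then show ?thesis using assms(1) by (auto simp: add.commute)
qed

lemma interior_scale:
  assumes "x \<in> interior C" "r > 0"
  shows "r *\<^sub>R x \<in> interior C"
proof -
  have "(*\<^sub>R) r ` interior C \<subseteq> C" using scale_mem assms(2) interior_mem by auto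
  then have "(*\<^sub>R) r ` interior C \<subseteq> interior C"
    using assms(2) by (intro interior_maximal open_scaling open_interior) auto
  then show ?thesis using assms(1) by auto
qed

lemma M_pos:
  assumes "x \<in> C - {0}" "y \<in> interior C"
  shows "M x y > 0"
proof (rule ccontr)
  assume "\<not> M x y > 0"
  then have "M x y *\<^sub>R y \<preceq> 0 *\<^sub>R y" using assms(2) by (intro le_scale_mono interior_mem) auto
  then have "x \<preceq> 0" using M_attained[OF assms(2), of x] le_trans by (metis scaleR_zero_left)
  then show False using antisym_mem[of x] assms(1) by (simp add: cone_le_def)
qed

lemma M_submult:
  assumes "x \<in> C - {0}" "y \<in> interior C" "z \<in> interior C"
  shows "M x z \<le> M x y * M y z"
proof (rule M_le)
  have "M x y *\<^sub>R y \<preceq> M x y *\<^sub>R (M y z *\<^sub>R z)"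
    using M_pos[OF assms(1,2)] by (intro le_scale M_attained assms) simp
  then show "x \<preceq> (M x y * M y z) *\<^sub>R z"
    using M_attained[OF assms(2), of x] le_trans by (metis scaleR_scaleR)
qed fact

lemma M_scale:
  assumes "y \<in> interior C" "s > 0"
  shows "M (s *\<^sub>R x) y = s * M x y"
proof (rule antisym)
  have *: "M (t *\<^sub>R w) y \<le> t * M w y" if "t > 0" for t w
    using le_scale[OF M_attained[OF assms(1), of w], of t] that assms(1) by (intro M_le) auto
  then show "M (s *\<^sub>R x) y \<le> s * M x y" using assms(2) .
  show "s * M x y \<le> M (s *\<^sub>R x) y"
    using *[of "1 / s" "s *\<^sub>R x"] assms(2) by (simp add: field_simps)
qed

text \<open>An interior point \<open>b\<close> is an order unit whose gauge is dominated by the norm. This makes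
  \<open>M(\<cdot>/x)\<close> Lipschitz for the norm on the whole space, so that passing to limits in the first
  argument needs no compactness.\<close>

lemma order_unit:
  assumes "b \<in> interior C"
  shows "\<exists>c>0. \<forall>w. w \<preceq> (c * norm w) *\<^sub>R b"
proof -
  obtain e where e: "e > 0" "cball b e \<subseteq> C"
    using assms mem_interior_cball by blast
  have "w \<preceq> ((1 / e) * norm w) *\<^sub>R b" for w
  proof (cases "w = 0")
    case True
    then show ?thesis using scale_mem[of b 0] interior_mem[OF assms] by (simp add: cone_le_def)
  next
    case False
    have "dist b (b - (e / norm w) *\<^sub>R w) = e" using False e(1) by (simp add: dist_norm)
    then have "b - (e / norm w) *\<^sub>R w \<in> C" using e(2) by auto
    then have "(norm w / e) *\<^sub>R (b - (e / norm w) *\<^sub>R w) \<in> C" using e(1) by (intro scale_mem) auto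
    moreover have "(norm w / e) *\<^sub>R (b - (e / norm w) *\<^sub>R w) = ((1 / e) * norm w) *\<^sub>R b - w"
      using False e(1) by (simp add: scaleR_diff_right)
    ultimately show ?thesis by (simp add: cone_le_def)
  qed
  then show ?thesis using e(1) by (intro exI[of _ "1 / e"]) simp
qed

lemma M_perturb:
  assumes c: "c > 0" "\<And>w. w \<preceq> (c * norm w) *\<^sub>R b" and "b \<in> interior C" "x \<in> interior C"
  shows "M z x \<le> M w x + c * norm (z - w) * M b x"
proof (rule M_le)
  have "(c * norm (z - w)) *\<^sub>R b \<preceq> (c * norm (z - w)) *\<^sub>R (M b x *\<^sub>R x)"
    using c(1) by (intro le_scale M_attained assms) simp
  from le_trans[OF c(2) this] have "z - w \<preceq> (c * norm (z - w) * M b x) *\<^sub>R x"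
    unfolding scaleR_scaleR .
  from le_add[OF M_attained[OF assms(4), of w] this]
  show "z \<preceq> (M w x + c * norm (z - w) * M b x) *\<^sub>R x" by (simp add: algebra_simps)
qed fact

lemma tendsto_M:
  assumes "(g \<longlongrightarrow> w) F" "x \<in> interior C"
  shows "((\<lambda>n. M (g n) x) \<longlongrightarrow> M w x) F"
proof -
  obtain c where c: "c > 0" "\<And>w. w \<preceq> (c * norm w) *\<^sub>R x" using order_unit[OF assms(2)] by blast
  have bound: "\<bar>M (g n) x - M w x\<bar> \<le> c * norm (g n - w)" for n
    using M_perturb[OF c assms(2,2), of "g n" w] M_perturb[OF c assms(2,2), of w "g n"]
    by (simp add: M_self[OF assms(2)] norm_minus_commute)
  have "((\<lambda>n. c * norm (g n - w)) \<longlongrightarrow> 0) F"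
    using tendsto_mult_right_zero[OF tendsto_norm_zero[OF LIM_zero[OF assms(1)]]] .
  then have "((\<lambda>n. M (g n) x - M w x) \<longlongrightarrow> 0) F"
    by (rule Lim_null_comparison[rotated]) (simp add: bound)
  then show ?thesis by (rule LIM_zero_cancel)
qed

lemma ln_M_perturb:
  assumes c: "c > 0" "\<And>w. w \<preceq> (c * norm w) *\<^sub>R b" and bx: "b \<in> interior C" "x \<in> interior C"
    and zw: "z \<in> C - {0}" "w \<in> C - {0}"
  shows "ln (M z x) - ln (M w x) \<le> c * norm (z - w) * (M b x * M x b) / M w b"
proof -
  note pos = M_pos[OF zw(1) bx(2)] M_pos[OF zw(2) bx(2)] M_pos[OF zw(2) bx(1)]
    M_pos_interior[OF bx] M_pos_interior[OF bx(2,1)]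
  have "ln (M z x) - ln (M w x) = ln (M z x / M w x)" using pos by (simp add: ln_div)
  also have "\<dots> \<le> M z x / M w x - 1" using pos by (intro ln_le_minus_one) simp
  also have "\<dots> \<le> c * norm (z - w) * M b x / M w x"
    using divide_right_mono[OF M_perturb[OF c bx, of z w], of "M w x"] pos
    by (simp add: add_divide_distrib)
  also have "\<dots> \<le> c * norm (z - w) * M b x / (M w b / M x b)"
    using pos c(1) M_submult[OF zw(2) bx(2,1)]
    by (intro divide_left_mono) (auto simp: field_simps)
  also have "\<dots> = c * norm (z - w) * (M b x * M x b) / M w b" by simp
  finally show ?thesis .
qed


section \<open>Limits of normalised reverse Funk distances\<close>

lemma RFunk_dist:
  assumes "x \<in> interior C" "y \<in> interior C"
  shows "RFunk C x y \<le> thompson_dist C x y"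
  unfolding RFunk_def thompson_dist_def using assms M_pos_interior[OF assms] M_pos_interior[OF assms(2,1)]
  by simp

lemma RFunk_diff_le:
  assumes "v \<in> C - {0}" "x \<in> interior C" "y \<in> interior C"
  shows "RFunk C x v - RFunk C y v \<le> RFunk C x y"
proof -
  note pos = M_pos[OF assms(1,2)] M_pos[OF assms(1,3)] M_pos_interior[OF assms(3,2)]
  have "ln (M v x) \<le> ln (M v y * M y x)"
    using M_submult[OF assms(1,3,2)] pos by simp
  then show ?thesis unfolding RFunk_def using pos by (simp add: ln_mult_pos)
qed

lemma topspace_thompson: "topspace (thompson_topology C) = interior C"
  unfolding thompson_topology_def
  by (simp add: Metric_space.topspace_mtopology[OF Metric_space_interior])

lemma i_R_continuous:
  assumes v: "v \<in> C - {0}"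
  shows "i_R C b v \<in> continuous_functions (thompson_topology C)"
proof -
  interpret T: Metric_space "interior C" "thompson_dist C" by (rule Metric_space_interior)
  have "\<bar>i_R C b v x - i_R C b v y\<bar> \<le> thompson_dist C x y"
    if "x \<in> interior C" "y \<in> interior C" for x y
    using RFunk_diff_le[OF v that] RFunk_diff_le[OF v that(2,1)] RFunk_dist[OF that]
      RFunk_dist[OF that(2,1)] that unfolding T.commute[of y x]
    by (simp add: i_R_def)
  then have "continuous_map T.mtopology Met_TC.mtopology (i_R C b v)"
    unfolding T.metric_continuous_map[OF Met_TC.Metric_space_axioms]
    by (auto simp: dist_real_def) (meson le_less_trans)
  then show ?thesis
    unfolding continuous_functions_def topspace_thompson
    by (simp add: thompson_topology_def) (simp add: i_R_def)
qed

text \<open>\<open>i_R\<close>, extended by the same formula to the nonzero points of the cone, is continuous from the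
  norm to uniform convergence on compact sets.\<close>

lemma limitin_i_R:
  assumes b: "b \<in> interior C" and v: "v \<in> C - {0}" and F: "((\<lambda>z. z) \<longlongrightarrow> v) F"
    and ev: "eventually (\<lambda>z. z \<in> C - {0}) F"
  shows "limitin (compact_convergence (thompson_topology C)) (i_R C b) (i_R C b v) F"
  unfolding limitin_def topspace_compact_convergence
proof (intro conjI allI impI)
  interpret T: Metric_space "interior C" "thompson_dist C" by (rule Metric_space_interior)
  show "i_R C b v \<in> continuous_functions (thompson_topology C)" using i_R_continuous[OF v] .
  fix U assume "openin (compact_convergence (thompson_topology C)) U \<and> i_R C b v \<in> U"
  then obtain K e where K: "compactin (thompson_topology C) K" and e: "e > 0"
    and U: "{g \<in> continuous_functions (thompson_topology C). \<forall>x\<in>K. \<bar>g x - i_R C b v x\<bar> < e} \<subseteq> U"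
    unfolding openin_compact_convergence by blast
  have "T.mbounded (insert b K)"
    using T.compactin_imp_mbounded[OF K[unfolded thompson_topology_def]] b
    by (simp add: T.mbounded_insert)
  then obtain R where KC: "K \<subseteq> interior C" and R: "\<And>x. x \<in> insert b K \<Longrightarrow> thompson_dist C x b \<le> R"
    unfolding T.mbounded_alt by blast
  obtain c where c: "c > 0" "\<And>w. w \<preceq> (c * norm w) *\<^sub>R b" using order_unit[OF b] by blast
  \<comment> \<open>Compact sets are bounded for Thompson's metric, so the constant in \<open>ln_M_perturb\<close> is uniform
    over \<open>K\<close> and the base point.\<close>
  define Q where "Q = exp R * exp R"
  have Q: "M b x * M x b \<le> Q" if "x \<in> insert b K" for x
  proof -
    have x: "x \<in> interior C" using that KC b by blast
    have "ln (M b x) \<le> R" "ln (M x b) \<le> R"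
      using RFunk_dist[OF x b] RFunk_dist[OF b x] R[OF that] T.commute[of x b]
      unfolding RFunk_def by linarith+
    then have "M b x \<le> exp R" "M x b \<le> exp R"
      using M_pos_interior[OF b x] M_pos_interior[OF x b] by (metis exp_le_cancel_iff exp_ln)+
    then show ?thesis
      unfolding Q_def using M_pos_interior[OF b x] M_pos_interior[OF x b] by (intro mult_mono) auto
  qed
  have vb: "M v b > 0" using M_pos[OF v b] .
  have "((\<lambda>z. M z b) \<longlongrightarrow> M v b) F" using tendsto_M[OF F b] .
  then have ev2: "eventually (\<lambda>z. M z b > M v b / 2) F" using vb by (intro order_tendstoD) auto
  define D where "D = c * Q / (M v b / 2)"
  have "((\<lambda>z. D * norm (z - v)) \<longlongrightarrow> D * norm (v - v)) F" by (intro tendsto_intros F)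
  then have ev3: "eventually (\<lambda>z. D * norm (z - v) < e / 2) F"
    using e by (intro order_tendstoD) auto
  show "eventually (\<lambda>z. i_R C b z \<in> U) F"
    using ev ev2 ev3
  proof eventually_elim
    case (elim z)
    have bound: "c * norm (z - v) * (M b x * M x b) / m \<le> D * norm (z - v)"
      if "x \<in> insert b K" "m \<ge> M v b / 2" for x m
    proof -
      have x: "x \<in> interior C" using that KC b by blast
      have "c * norm (z - v) * (M b x * M x b) / m \<le> c * norm (z - v) * Q / (M v b / 2)"
        using Q[OF that(1)] that(2) vb c(1) M_pos_interior[OF b x] M_pos_interior[OF x b]
        by (intro frac_le mult_left_mono mult_nonneg_nonneg) (auto intro: order_trans[rotated])
      then show ?thesis unfolding D_def by (simp add: mult_ac)
    qed
    have close: "\<bar>ln (M z x) - ln (M v x)\<bar> < e / 2" if "x \<in> insert b K" for x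
    proof -
      have x: "x \<in> interior C" using that KC b by blast
      have "ln (M z x) - ln (M v x) \<le> D * norm (z - v)"
        using ln_M_perturb[OF c b x elim(1) v] bound[OF that, of "M v b"] vb by linarith
      moreover have "ln (M v x) - ln (M z x) \<le> D * norm (z - v)"
        using ln_M_perturb[OF c b x v elim(1)] bound[OF that, of "M z b"] elim(2)
        unfolding norm_minus_commute[of v z] by linarith
      ultimately show ?thesis using elim(3) by linarith
    qed
    have "\<bar>i_R C b z x - i_R C b v x\<bar> < e" if "x \<in> K" for x
    proof -
      have "i_R C b z x - i_R C b v x = (ln (M z x) - ln (M v x)) - (ln (M z b) - ln (M v b))"
        using that KC by (auto simp: i_R_def RFunk_def)
      then show ?thesis using close[of x] close[of b] that unfolding abs_less_iff by auto
    qed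
    then show ?case using U i_R_continuous[OF elim(1)] by blast
  qed
qed

lemma order_unit_norm_eq_M:
  assumes "v \<in> C - {0}" "b \<in> interior C"
  shows "order_unit_norm C b v = M v b"
proof -
  have "r \<ge> 0 \<and> - (r *\<^sub>R b) \<preceq> v" if "v \<preceq> r *\<^sub>R b" for r
  proof -
    have "r \<ge> 0" using M_le[OF assms(2) that] M_pos[OF assms] by simp
    moreover have "v + r *\<^sub>R b \<in> C"
      using assms \<open>r \<ge> 0\<close> by (auto intro: add_mem scale_mem interior_mem)
    ultimately show ?thesis by (simp add: cone_le_def)
  qed
  then have "{r. r \<ge> 0 \<and> - (r *\<^sub>R b) \<preceq> v \<and> v \<preceq> r *\<^sub>R b} = {r. v \<preceq> r *\<^sub>R b}" by blast
  then show ?thesis unfolding order_unit_norm_def M_fun_def by simp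
qed

text \<open>Normalising by \<open>M(v/b)\<close> does not change the function, and the points \<open>w + t b\<close> approach the
  normalised point \<open>w\<close> from within the interior.\<close>

lemma i_R_mem_A_R:
  assumes b: "b \<in> interior C" and v: "v \<in> C - {0}"
  shows "i_R C b v \<in> A_R C b"
proof -
  define s where "s = 1 / M v b"
  define w where "w = s *\<^sub>R v"
  have s: "s > 0" unfolding s_def using M_pos[OF v b] by simp
  have w: "w \<in> C - {0}" unfolding w_def using v s scale_mem[of v s] by auto
  have "M w b = 1" unfolding w_def M_scale[OF b s] unfolding s_def using M_pos[OF v b] by simp
  then have norm_w: "order_unit_norm C b w = 1" using order_unit_norm_eq_M[OF w b] by simp
  have eq: "i_R C b w = i_R C b v"
    unfolding i_R_def
  proof (rule restrict_ext)
    fix x assume "x \<in> interior C"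
    then show "RFunk C x w - RFunk C b w = RFunk C x v - RFunk C b v"
      unfolding RFunk_def w_def using s b M_pos[OF v] by (simp add: M_scale ln_mult_pos)
  qed
  define F where "F = filtermap (\<lambda>t. w + t *\<^sub>R b) (at_right 0)"
  have F: "F \<noteq> bot" unfolding F_def by (simp add: filtermap_bot_iff)
  have ev: "eventually (\<lambda>z. z \<in> interior C) F"
    unfolding F_def eventually_filtermap
    using interior_add[OF interior_scale[OF b]] w
    by (auto simp: eventually_at_right_field add.commute[of w] intro!: exI[of _ 1])
  have "((\<lambda>t. w + t *\<^sub>R b) \<longlongrightarrow> w + 0 *\<^sub>R b) (at_right 0)" by (intro tendsto_intros)
  then have lim: "((\<lambda>z. z) \<longlongrightarrow> w) F" unfolding F_def by (simp add: tendsto_def eventually_filtermap)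
  have conv: "limitin (compact_convergence (thompson_topology C)) (i_R C b) (i_R C b v) F"
    using limitin_i_R[OF b w lim] eventually_mono[OF ev interior_nonzero] eq by simp
  have "i_R C b v \<in> RFunk_closure C b"
    unfolding RFunk_closure_def in_closure_of
  proof (intro conjI allI impI)
    show "i_R C b v \<in> topspace (compact_convergence (thompson_topology C))"
      using conv unfolding limitin_def by blast
    fix U
    assume "i_R C b v \<in> U \<and> openin (compact_convergence (thompson_topology C)) U"
    then have "eventually (\<lambda>z. i_R C b z \<in> U) F" using conv unfolding limitin_def by blast
    then have "eventually (\<lambda>z. i_R C b z \<in> U \<and> z \<in> interior C) F" using ev by eventually_elim simp
    then show "\<exists>y. y \<in> i_R C b ` interior C \<and> y \<in> U" using eventually_happens'[OF F] by blast
  qed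
  then show ?thesis unfolding A_R_def using F ev w lim norm_w conv by blast
qed

text \<open>Evaluation at two points is continuous for compact convergence, because finite sets are
  compact.\<close>

lemma RFunk_closure_diff_le:
  assumes h: "h \<in> RFunk_closure C b" and x: "x \<in> interior C" and y: "y \<in> interior C"
  shows "h x - h y \<le> RFunk C x y"
proof (rule ccontr)
  assume less: "\<not> h x - h y \<le> RFunk C x y"
  let ?T = "thompson_topology C"
  define U where "U = {g \<in> continuous_functions ?T. g x - g y > RFunk C x y}"
  have "openin (compact_convergence ?T) U"
    unfolding openin_compact_convergence
  proof (intro conjI ballI)
    fix g assume g: "g \<in> U"
    define e where "e = (g x - g y - RFunk C x y) / 2"
    have "compactin ?T {x, y}"
      using x y by (intro finite_imp_compactin) (auto simp: topspace_thompson)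
    moreover have "e > 0" using g unfolding e_def U_def by simp
    moreover have "{k \<in> continuous_functions ?T. \<forall>z\<in>{x, y}. \<bar>k z - g z\<bar> < e} \<subseteq> U"
    proof
      fix k assume "k \<in> {k \<in> continuous_functions ?T. \<forall>z\<in>{x, y}. \<bar>k z - g z\<bar> < e}"
      then have "k \<in> continuous_functions ?T" "\<bar>k x - g x\<bar> < e" "\<bar>k y - g y\<bar> < e" by auto
      then show "k \<in> U" unfolding U_def e_def unfolding abs_less_iff by (auto simp: field_simps)
    qed
    ultimately show "\<exists>K e. compactin ?T K \<and> 0 < e \<and>
        {k \<in> continuous_functions ?T. \<forall>z\<in>K. \<bar>k z - g z\<bar> < e} \<subseteq> U" by blast
  qed (auto simp: U_def)
  moreover have "h \<in> U"
    using h less unfolding RFunk_closure_def in_closure_of U_def topspace_compact_convergence by simp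
  ultimately obtain z where z: "z \<in> interior C" "i_R C b z \<in> U"
    using h unfolding RFunk_closure_def in_closure_of by blast
  then show False
    using RFunk_diff_le[OF interior_nonzero[OF z(1)] x y] x y by (simp add: U_def i_R_def)
qed

text \<open>The extended \<open>i_R\<close> separates boundary points from interior points: evaluating at \<open>v + t y\<close>
  and letting \<open>t\<close> tend to 0 shows that a positive multiple of \<open>y\<close> lies below \<open>v\<close>.\<close>

lemma i_R_eq_imp_interior:
  assumes b: "b \<in> interior C" and v: "v \<in> C - {0}" and y: "y \<in> interior C"
    and eq: "i_R C b v = i_R C b y"
  shows "v \<in> interior C"
proof -
  define c where "c = M v b / M y b"
  have c: "c > 0" unfolding c_def using M_pos[OF v b] M_pos_interior[OF y b] by simp
  have Meq: "M v x = c * M y x" if x: "x \<in> interior C" for x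
  proof -
    note pos = M_pos[OF v x] M_pos_interior[OF y x] M_pos[OF v b] M_pos_interior[OF y b]
    have "ln (M v x) - ln (M v b) = ln (M y x) - ln (M y b)"
      using fun_cong[OF eq, of x] x by (simp add: i_R_def RFunk_def)
    then have "ln (M v x) = ln (c * M y x)"
      unfolding c_def using pos by (simp add: ln_mult_pos ln_div)
    then show ?thesis using pos c by simp
  qed
  have "c *\<^sub>R y \<preceq> v + t *\<^sub>R y" if t: "t > 0" for t
  proof -
    define x where "x = v + t *\<^sub>R y"
    have x: "x \<in> interior C"
      unfolding x_def using interior_add[OF interior_scale[OF y t]] v by (simp add: add.commute)
    have "v \<preceq> 1 *\<^sub>R x"
      unfolding x_def cone_le_def using scale_mem[of y t] interior_mem[OF y] t by simp
    then have "c * M y x \<le> 1" using M_le[OF x] Meq[OF x] by metis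
    then have "c *\<^sub>R (M y x *\<^sub>R x) \<preceq> 1 *\<^sub>R x"
      unfolding scaleR_scaleR by (rule le_scale_mono[OF interior_mem[OF x]])
    then show ?thesis
      using le_trans[OF le_scale[OF M_attained[OF x, of y], of c]] c unfolding x_def by simp
  qed
  then have "eventually (\<lambda>t. c *\<^sub>R y \<preceq> v + t *\<^sub>R y) (at_right 0)"
    by (auto simp: eventually_at_right_field intro!: exI[of _ 1])
  moreover have "((\<lambda>t. v + t *\<^sub>R y) \<longlongrightarrow> v + 0 *\<^sub>R y) (at_right 0)" by (intro tendsto_intros)
  ultimately have "c *\<^sub>R y \<preceq> v + 0 *\<^sub>R y"
    by (intro le_limit[OF tendsto_const]) auto
  then have "v - c *\<^sub>R y \<in> C" by (simp add: cone_le_def)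
  from interior_add[OF interior_scale[OF y c] this] show ?thesis by simp
qed

end


section \<open>Approximate eigenvectors\<close>

locale homogeneous_map = closed_pointed_cone C
  for C :: "'a::real_normed_vector set" +
  fixes f :: "'a \<Rightarrow> 'a"
  assumes f_interior: "x \<in> interior C \<Longrightarrow> f x \<in> interior C"
    and f_mono: "x \<in> interior C \<Longrightarrow> y \<in> interior C \<Longrightarrow> x \<preceq> y \<Longrightarrow> f x \<preceq> f y"
    and f_homogeneous: "x \<in> interior C \<Longrightarrow> s > 0 \<Longrightarrow> f (s *\<^sub>R x) = s *\<^sub>R f x"
begin

lemma f_le_scale:
  assumes "x \<in> interior C" "y \<in> interior C" "s > 0" "x \<preceq> s *\<^sub>R y"
  shows "f x \<preceq> s *\<^sub>R f y"
  using f_mono[OF assms(1) interior_scale[OF assms(2,3)] assms(4)] f_homogeneous[OF assms(2,3)] by simp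

lemma iterate_interior: "x \<in> interior C \<Longrightarrow> (f ^^ k) x \<in> interior C"
  by (induction k) (auto intro: f_interior)

lemma iterate_le_scale:
  assumes "x \<in> interior C" "y \<in> interior C" "s > 0" "x \<preceq> s *\<^sub>R y"
  shows "(f ^^ k) x \<preceq> s *\<^sub>R (f ^^ k) y"
  by (induction k) (use assms in \<open>auto intro: f_le_scale iterate_interior\<close>)

lemma iterate_subeigenvector:
  assumes "x \<in> interior C" "r > 0" "f x \<preceq> r *\<^sub>R x"
  shows "(f ^^ k) x \<preceq> r ^ k *\<^sub>R x"
proof (induction k)
  case 0
  then show ?case using le_scale_mono[OF interior_mem[OF assms(1)], of 1 1] by simp
next
  case (Suc k)
  have "(f ^^ Suc k) x \<preceq> r ^ k *\<^sub>R f x"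
    using f_le_scale[OF iterate_interior[OF assms(1)] assms(1) _ Suc] assms(2) by simp
  moreover have "r ^ k *\<^sub>R f x \<preceq> r ^ k *\<^sub>R (r *\<^sub>R x)"
    using le_scale[OF assms(3)] assms(2) by simp
  ultimately have "(f ^^ Suc k) x \<preceq> r ^ k *\<^sub>R (r *\<^sub>R x)" by (rule le_trans)
  then show ?case by (simp add: mult.commute)
qed

end

text \<open>The function \<open>p\<close> plays the role of the monotone norm and \<open>u\<close> that of the direction of the
  perturbation; of the norm axioms, only positive homogeneity and monotonicity matter here.\<close>

locale perturbed_map = homogeneous_map C f
  for C :: "'a::real_normed_vector set" and f +
  fixes p :: "'a \<Rightarrow> real" and u :: 'a
  assumes p_scale: "s > 0 \<Longrightarrow> p (s *\<^sub>R x) = s * p x"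
    and p_mono: "x \<in> C \<Longrightarrow> x \<preceq> y \<Longrightarrow> p x \<le> p y"
    and u: "u \<in> interior C"
begin

text \<open>The vector \<open>v\<close> is normalised by \<open>p v = 1\<close> and an eigenvector of \<open>x \<mapsto> f x + e p(x) u\<close> with
  eigenvalue \<open>r\<close>.\<close>

definition perturbed_eigenpair :: "real \<Rightarrow> real \<Rightarrow> 'a \<Rightarrow> bool" where
  "perturbed_eigenpair e r v \<longleftrightarrow> e > 0 \<and> v \<in> interior C \<and> p v = 1 \<and> f v + e *\<^sub>R u = r *\<^sub>R v"

lemma perturbed_eigenpair_subeigenvector:
  assumes "perturbed_eigenpair e r v"
  shows "f v \<preceq> r *\<^sub>R v"
proof -
  have "r *\<^sub>R v - f v = e *\<^sub>R u" using assms unfolding perturbed_eigenpair_def by (simp add: algebra_simps)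
  then show ?thesis
    using assms scale_mem[OF interior_mem[OF u], of e] unfolding perturbed_eigenpair_def cone_le_def
    by simp
qed

text \<open>This is homogeneity and monotonicity of the perturbed map, applied to \<open>v \<preceq> M(v/x) x\<close>.\<close>

lemma perturbed_eigenpair_le:
  assumes v: "perturbed_eigenpair e r v" and x: "x \<in> interior C"
  shows "r *\<^sub>R v \<preceq> M v x *\<^sub>R (f x + (e * p x) *\<^sub>R u)"
proof -
  have vi: "v \<in> interior C" and e: "e > 0" and pv: "p v = 1" and eq: "r *\<^sub>R v = f v + e *\<^sub>R u"
    using v unfolding perturbed_eigenpair_def by simp_all
  have pos: "M v x > 0" using M_pos_interior[OF vi x] .
  have "1 \<le> M v x * p x"
    using p_mono[OF interior_mem[OF vi] M_attained[OF x, of v]] p_scale[OF pos] pv by simp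
  then have "e \<le> M v x * (e * p x)" using e by (simp add: mult.left_commute)
  then have "e *\<^sub>R u \<preceq> (M v x * (e * p x)) *\<^sub>R u" by (rule le_scale_mono[OF interior_mem[OF u]])
  from le_add[OF f_le_scale[OF vi x pos M_attained[OF x]] this]
  show ?thesis unfolding eq by (simp add: scaleR_add_right)
qed

lemma eigenvalue_lower_bound:
  assumes v: "perturbed_eigenpair e r v" and b: "b \<in> interior C" and a: "a > 0" "a *\<^sub>R b \<preceq> f b"
  shows "a \<le> r"
proof -
  have vi: "v \<in> interior C" using v unfolding perturbed_eigenpair_def by simp
  have pos: "M b v > 0" using M_pos_interior[OF b vi] .
  have "f b \<preceq> M b v *\<^sub>R f v" using f_le_scale[OF b vi pos M_attained[OF vi]] .
  then have "a *\<^sub>R b \<preceq> M b v *\<^sub>R (r *\<^sub>R v)"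
    using le_trans[OF a(2)] le_trans le_scale[OF perturbed_eigenpair_subeigenvector[OF v]] pos
    by (meson less_imp_le)
  then have "a *\<^sub>R b \<preceq> (M b v * r) *\<^sub>R v" by simp
  then have "M (a *\<^sub>R b) v \<le> M b v * r" by (rule M_le[OF vi])
  then show ?thesis using pos a(1) by (simp add: M_scale[OF vi])
qed

lemma eigenvalue_upper_bound:
  assumes v: "perturbed_eigenpair e r v" and b: "b \<in> interior C" and r: "r > 0"
  shows "r \<le> M (f b) b + e * p b * M u b"
proof -
  have vi: "v \<in> interior C" and e: "e > 0"
    using v unfolding perturbed_eigenpair_def by simp_all
  have pos: "M v b > 0" using M_pos_interior[OF vi b] .
  have "(0::'a) \<preceq> b" using interior_mem[OF b] by (simp add: cone_le_def)
  have "0 \<in> C" using scale_mem[OF interior_mem[OF b], of 0] by simp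
  have "p 0 = 0" using p_scale[of 2 0] by simp
  then have pb: "p b \<ge> 0" using p_mono[OF \<open>0 \<in> C\<close> \<open>0 \<preceq> b\<close>] by simp
  have "(e * p b) *\<^sub>R u \<preceq> (e * p b) *\<^sub>R (M u b *\<^sub>R b)"
    using e pb by (intro le_scale M_attained b) simp
  from le_add[OF M_attained[OF b, of "f b"] this]
  have "f b + (e * p b) *\<^sub>R u \<preceq> (M (f b) b + e * p b * M u b) *\<^sub>R b"
    by (simp add: algebra_simps)
  from le_scale[OF this, of "M v b"] pos
  have "M v b *\<^sub>R (f b + (e * p b) *\<^sub>R u) \<preceq> (M v b * (M (f b) b + e * p b * M u b)) *\<^sub>R b" by simp
  from le_trans[OF perturbed_eigenpair_le[OF v b] this]
  have "M (r *\<^sub>R v) b \<le> M v b * (M (f b) b + e * p b * M u b)" by (rule M_le[OF b])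
  then show ?thesis using pos r by (simp add: M_scale[OF b] mult.commute[of r])
qed

lemma convergent_eigenvalue_subsequence:
  assumes pair: "\<And>n. perturbed_eigenpair (\<epsilon> n) (r n) (v n)" and \<epsilon>: "\<epsilon> \<longlonglongrightarrow> 0"
  obtains \<rho> and \<sigma> :: "nat \<Rightarrow> nat" where "\<rho> > 0" "strict_mono \<sigma>" "(\<lambda>n. r (\<sigma> n)) \<longlonglongrightarrow> \<rho>"
proof -
  \<comment> \<open>The largest \<open>a\<close> with \<open>a u \<preceq> f u\<close>; it bounds all eigenvalues from below.\<close>
  define a where "a = 1 / M u (f u)"
  have fu: "f u \<in> interior C" using f_interior[OF u] .
  have a: "a > 0" unfolding a_def using M_pos_interior[OF u fu] by simp
  have "a *\<^sub>R u \<preceq> f u"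
    using le_scale[OF M_attained[OF fu, of u], of a] a M_pos_interior[OF u fu] by (simp add: a_def)
  then have lower: "a \<le> r n" for n using eigenvalue_lower_bound[OF pair u a] by simp
  define B where "B n = M (f u) u + \<epsilon> n * p u * M u u" for n
  have upper: "r n \<le> B n" for n
    using eigenvalue_upper_bound[OF pair u] lower[of n] a unfolding B_def by simp
  have "B \<longlonglongrightarrow> M (f u) u + 0 * p u * M u u" unfolding B_def by (intro tendsto_intros \<epsilon>)
  then have "Bseq B" by (intro convergent_imp_Bseq convergentI)
  then obtain K where "\<And>n. norm (B n) \<le> K" unfolding Bseq_def by blast
  then have "r n \<le> K" for n using upper[of n] by (smt (verit) real_norm_def)
  then have "\<forall>n. r n \<in> {a..K}" using lower by simp
  then obtain \<rho> and \<sigma> :: "nat \<Rightarrow> nat" where "\<rho> \<in> {a..K}" "strict_mono \<sigma>" "(r \<circ> \<sigma>) \<longlonglongrightarrow> \<rho>"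
    using compact_Icc[of a K] unfolding compact_eq_seq_compact_metric seq_compact_def by blast
  then show ?thesis using that[of \<rho> \<sigma>] a by (simp add: o_def)
qed

end

text \<open>A norm convergent sequence of approximate eigenvectors whose eigenvalues converge as well.\<close>

locale approximate_eigenvectors = perturbed_map C f p u
  for C :: "'a::real_normed_vector set" and f p u +
  fixes \<epsilon> :: "nat \<Rightarrow> real" and r v w \<rho>
  assumes pair: "\<And>n. perturbed_eigenpair (\<epsilon> n) (r n) (v n)"
    and \<epsilon>_lim: "\<epsilon> \<longlonglongrightarrow> 0" and v_lim: "v \<longlonglongrightarrow> w" and r_lim: "r \<longlonglongrightarrow> \<rho>"
    and w_nonzero: "w \<noteq> 0" and \<rho>_pos: "\<rho> > 0"
begin

lemma v_interior: "v n \<in> interior C"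
  using pair[of n] unfolding perturbed_eigenpair_def by simp

lemma w_mem: "w \<in> C - {0}"
  using closed_sequentially[OF C(2) _ v_lim] interior_mem[OF v_interior] w_nonzero by blast

lemma limit_le:
  assumes x: "x \<in> interior C"
  shows "\<rho> *\<^sub>R w \<preceq> M w x *\<^sub>R f x"
proof -
  have "(\<lambda>n. M (v n) x *\<^sub>R (f x + (\<epsilon> n * p x) *\<^sub>R u)) \<longlonglongrightarrow> M w x *\<^sub>R (f x + (0 * p x) *\<^sub>R u)"
    by (intro tendsto_intros tendsto_M[OF v_lim x] \<epsilon>_lim)
  then have "\<rho> *\<^sub>R w \<preceq> M w x *\<^sub>R (f x + (0 * p x) *\<^sub>R u)"
    using perturbed_eigenpair_le[OF pair x]
    by (intro le_limit[OF tendsto_scaleR[OF r_lim v_lim]]) auto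
  then show ?thesis by simp
qed

lemma RFunk_gain:
  assumes x: "x \<in> interior C"
  shows "ln \<rho> \<le> RFunk C x w - RFunk C (f x) w"
proof -
  note fx = f_interior[OF x]
  have "\<rho> * M w (f x) \<le> M w x"
    using M_le[OF fx limit_le[OF x]] unfolding M_scale[OF fx \<rho>_pos] .
  then have "ln (\<rho> * M w (f x)) \<le> ln (M w x)"
    using \<rho>_pos M_pos[OF w_mem fx] by (intro ln_mono) auto
  then show ?thesis
    unfolding RFunk_def using \<rho>_pos M_pos[OF w_mem fx] by (simp add: ln_mult_pos)
qed

lemma RFunk_iterate_lower:
  assumes x: "x \<in> interior C"
  shows "real k * ln \<rho> \<le> RFunk C x ((f ^^ k) x)"
proof -
  have "real k * ln \<rho> \<le> RFunk C x w - RFunk C ((f ^^ k) x) w"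
  proof (induction k)
    case (Suc k)
    then show ?case using RFunk_gain[OF iterate_interior[OF x, of k]] by (simp add: algebra_simps)
  qed simp
  also have "\<dots> \<le> RFunk C x ((f ^^ k) x)" by (rule RFunk_diff_le[OF w_mem x iterate_interior[OF x]])
  finally show ?thesis .
qed

lemma RFunk_iterate_upper:
  assumes x: "x \<in> interior C" and r: "r n > 0"
  shows "RFunk C x ((f ^^ k) x) \<le> real k * ln (r n) + ln (M x (v n) * M (v n) x)"
proof -
  note vi = v_interior[of n]
  define a where "a = M x (v n)"
  define a' where "a' = M (v n) x"
  have pos: "a > 0" "a' > 0" unfolding a_def a'_def using M_pos_interior x vi by auto
  have "(f ^^ k) x \<preceq> a *\<^sub>R (f ^^ k) (v n)"
    using iterate_le_scale[OF x vi pos(1)] M_attained[OF vi] unfolding a_def by blast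
  moreover have "a *\<^sub>R (f ^^ k) (v n) \<preceq> a *\<^sub>R (r n ^ k *\<^sub>R v n)"
    using iterate_subeigenvector[OF vi r perturbed_eigenpair_subeigenvector[OF pair]] pos
    by (intro le_scale) auto
  moreover have "(a * r n ^ k) *\<^sub>R v n \<preceq> (a * r n ^ k) *\<^sub>R (a' *\<^sub>R x)"
    using M_attained[OF x, of "v n"] pos r unfolding a'_def by (intro le_scale) auto
  ultimately have "(f ^^ k) x \<preceq> (a * r n ^ k) *\<^sub>R (a' *\<^sub>R x)"
    unfolding scaleR_scaleR by (meson le_trans)
  then have "(f ^^ k) x \<preceq> (r n ^ k * (a * a')) *\<^sub>R x" by (simp add: mult_ac)
  then have "M ((f ^^ k) x) x \<le> r n ^ k * (a * a')" by (rule M_le[OF x])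
  then have "ln (M ((f ^^ k) x) x) \<le> ln (r n ^ k * (a * a'))"
    using M_pos_interior[OF iterate_interior[OF x] x] by (intro ln_mono) auto
  also have "\<dots> = real k * ln (r n) + ln (a * a')"
    using r pos by (simp add: ln_mult_pos ln_realpow)
  finally show ?thesis unfolding RFunk_def a_def a'_def .
qed

lemma RFunk_rate:
  assumes x: "x \<in> interior C"
  shows "(\<lambda>k. RFunk C x ((f ^^ k) x) / real k) \<longlonglongrightarrow> ln \<rho>"
proof (rule order_tendstoI)
  fix a assume a: "a < ln \<rho>"
  show "eventually (\<lambda>k. a < RFunk C x ((f ^^ k) x) / real k) sequentially"
    using eventually_gt_at_top[of 0]
  proof eventually_elim
    case (elim k)
    have "ln \<rho> \<le> RFunk C x ((f ^^ k) x) / real k"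
      using RFunk_iterate_lower[OF x, of k] elim by (simp add: field_simps)
    then show ?case using a by simp
  qed
next
  fix a assume a: "a > ln \<rho>"
  have "(\<lambda>n. ln (r n)) \<longlonglongrightarrow> ln \<rho>" using \<rho>_pos by (intro tendsto_ln r_lim) auto
  then have "eventually (\<lambda>n. ln (r n) < a \<and> r n > 0) sequentially"
    using order_tendstoD(2)[OF _ a] order_tendstoD(1)[OF r_lim \<rho>_pos] eventually_conj by blast
  then obtain n where n: "ln (r n) < a" "r n > 0"
    using eventually_happens'[OF sequentially_bot] by blast
  let ?c = "ln (M x (v n) * M (v n) x)"
  have "(\<lambda>k. ln (r n) + ?c * inverse (real k)) \<longlonglongrightarrow> ln (r n) + ?c * 0"
    by (intro tendsto_intros LIMSEQ_inverse_real_of_nat[THEN filterlim_sequentially_Suc[THEN iffD1]])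
  then have "eventually (\<lambda>k. ln (r n) + ?c * inverse (real k) < a) sequentially"
    using n(1) by (intro order_tendstoD) auto
  then show "eventually (\<lambda>k. RFunk C x ((f ^^ k) x) / real k < a) sequentially"
    using eventually_gt_at_top[of 0]
  proof eventually_elim
    case (elim k)
    have "RFunk C x ((f ^^ k) x) / real k \<le> (real k * ln (r n) + ?c) / real k"
      using RFunk_iterate_upper[OF x n(2)] by (intro divide_right_mono) auto
    also have "\<dots> = ln (r n) + ?c * inverse (real k)" using elim(2) by (simp add: field_simps)
    finally show ?case using elim(1) by simp
  qed
qed

lemma escape_rate_eq: "escape_rate C f = ln \<rho>"
  unfolding escape_rate_def
  using RFunk_rate v_interior[of 0] by (blast intro: LIMSEQ_unique)

lemma interior_limit_eigenvector:
  assumes w: "w \<in> interior C"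
  shows "f w = \<rho> *\<^sub>R w"
proof (rule le_antisym)
  obtain c where c: "c > 0" "\<And>x. x \<preceq> (c * norm x) *\<^sub>R w" using order_unit[OF w] by blast
  define \<eta> where "\<eta> n = c * norm (w - v n)" for n
  have "\<eta> \<longlonglongrightarrow> c * norm (w - w)" unfolding \<eta>_def by (intro tendsto_intros v_lim)
  then have \<eta>: "\<eta> \<longlonglongrightarrow> 0" by simp
  have "eventually (\<lambda>n. \<eta> n < 1) sequentially" using \<eta> by (rule order_tendstoD) simp
  then have "eventually (\<lambda>n. (1 - \<eta> n) *\<^sub>R f w \<preceq> r n *\<^sub>R v n) sequentially"
  proof eventually_elim
    case (elim n)
    \<comment> \<open>As \<open>w\<close> is itself an order unit, \<open>w - v n \<preceq> \<eta> n w\<close>.\<close>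
    have "(1 - \<eta> n) *\<^sub>R w \<preceq> v n"
      using c(2)[of "w - v n"] unfolding \<eta>_def cone_le_def by (simp add: algebra_simps)
    then have "(1 - \<eta> n) *\<^sub>R f w \<preceq> f (v n)"
      using f_mono[OF interior_scale[OF w] v_interior] f_homogeneous[OF w] elim by force
    then show ?case using perturbed_eigenpair_subeigenvector[OF pair] le_trans by blast
  qed
  then have "(1 - 0) *\<^sub>R f w \<preceq> \<rho> *\<^sub>R w"
    by (rule le_limit[rotated 2]) (intro tendsto_intros \<eta> r_lim v_lim sequentially_bot)+
  then show "f w \<preceq> \<rho> *\<^sub>R w" by simp
  show "\<rho> *\<^sub>R w \<preceq> f w" using limit_le[OF w] by (simp add: M_self[OF w])
qed


section \<open>The variational formula\<close>

lemma INF_le_escape_rate: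
  assumes h: "h \<in> RFunk_closure C b"
  shows "(INF x\<in>interior C. ereal (h x - h (f x))) \<le> ereal (escape_rate C f)"
proof (rule ccontr)
  assume "\<not> ?thesis"
  then have "ereal (ln \<rho>) < (INF x\<in>interior C. ereal (h x - h (f x)))"
    unfolding escape_rate_eq not_le .
  then obtain s where "ereal (ln \<rho>) < ereal s"
    and s2: "ereal s < (INF x\<in>interior C. ereal (h x - h (f x)))"
    by (blast dest: ereal_dense2)
  then have s: "ln \<rho> < s" by simp
  have gain: "s \<le> h x - h (f x)" if "x \<in> interior C" for x
    using less_le_trans[OF s2 INF_lower[OF that]] by simp
  define x where "x = v 0"
  have x: "x \<in> interior C" unfolding x_def by (rule v_interior)
  have iter: "real k * s \<le> h x - h ((f ^^ k) x)" for k
  proof (induction k)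
    case (Suc k)
    then show ?case using gain[OF iterate_interior[OF x, of k]] by (simp add: algebra_simps)
  qed simp
  have "s \<le> RFunk C x ((f ^^ k) x) / real k" if "k > 0" for k
    using order_trans[OF iter RFunk_closure_diff_le[OF h x iterate_interior[OF x, of k]]] that
    by (simp add: field_simps)
  then have "s \<le> ln \<rho>"
    by (intro LIMSEQ_le_const[OF RFunk_rate[OF x]] exI[of _ 1]) auto
  then show False using s by simp
qed

lemma INF_i_R_limit:
  assumes b: "b \<in> interior C"
  shows "(INF x\<in>interior C. ereal (i_R C b w x - i_R C b w (f x))) = ereal (escape_rate C f)"
proof (rule antisym)
  have "i_R C b w \<in> RFunk_closure C b" using i_R_mem_A_R[OF b w_mem] unfolding A_R_def by blast
  then show "(INF x\<in>interior C. ereal (i_R C b w x - i_R C b w (f x))) \<le> ereal (escape_rate C f)"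
    by (rule INF_le_escape_rate)
  show "ereal (escape_rate C f) \<le> (INF x\<in>interior C. ereal (i_R C b w x - i_R C b w (f x)))"
    unfolding escape_rate_eq
    using RFunk_gain f_interior by (intro INF_greatest) (simp add: i_R_def)
qed

lemma i_R_limit_horofunction:
  assumes b: "b \<in> interior C" and no_eigenvector: "\<nexists>x. is_eigenvector_in (interior C) f x"
  shows "i_R C b w \<in> horofunctions_R C b"
proof -
  have "i_R C b w \<notin> i_R C b ` interior C"
  proof
    assume "i_R C b w \<in> i_R C b ` interior C"
    then have w: "w \<in> interior C" using i_R_eq_imp_interior[OF b w_mem] by blast
    then have "is_eigenvector_in (interior C) f w"
      using interior_limit_eigenvector[OF w] w_nonzero unfolding is_eigenvector_in_def by blast
    then show False using no_eigenvector by blast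
  qed
  then show ?thesis
    using i_R_mem_A_R[OF b w_mem] unfolding horofunctions_R_def A_R_def by blast
qed

end

theorem corollary6p4:
  fixes C :: "'a::banach set" and f :: "'a \<Rightarrow> 'a" and b u :: 'a and p :: "'a \<Rightarrow> real"
  assumes "pointed_convex_cone C" and "closed C" and "normal_cone C" and "interior C \<noteq> {}"
    and "f \<in> interior C \<rightarrow> interior C"
    and "order_preserving_on C (interior C) f"
    and "homogeneous_on (interior C) f"
    and "b \<in> interior C"
    and "equivalent_norm p" and "monotone_norm C p"
    and "u \<in> interior C" and "norm u = 1"
    and "converging_approx_eigenvectors C f p u"
  shows "((\<exists>h\<in>A_R C b. ereal (escape_rate C f) = (INF x\<in>interior C. ereal (h x - h (f x)))) \<and>
          (\<forall>h\<in>A_R C b. (INF x\<in>interior C. ereal (h x - h (f x))) \<le> ereal (escape_rate C f))) \<and>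
         ((\<nexists>v. is_eigenvector_in (interior C) f v) \<longrightarrow>
          (\<exists>h\<in>A_R C b \<inter> horofunctions_R C b.
            ereal (escape_rate C f) = (INF x\<in>interior C. ereal (h x - h (f x)))))"
proof -
  \<comment> \<open>Otherwise a small multiple of \<open>u\<close> and its negative would both lie in \<open>C\<close>.\<close>
  have "0 \<notin> interior C"
  proof
    assume "0 \<in> interior C"
    then obtain d where d: "d > 0" "cball 0 d \<subseteq> C" using mem_interior_cball by blast
    then have "d *\<^sub>R u \<in> C" "- (d *\<^sub>R u) \<in> C" using assms(12) by (auto simp: subset_iff)
    then have "d *\<^sub>R u \<in> C \<inter> uminus ` C" by force
    then have "d *\<^sub>R u = 0" using assms(1) unfolding pointed_convex_cone_def by blast
    then show False using d(1) assms(12) by auto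
  qed
  then interpret perturbed_map C f p u
    using assms unfolding perturbed_map_def perturbed_map_axioms_def homogeneous_map_def
      homogeneous_map_axioms_def closed_pointed_cone_def order_preserving_on_def homogeneous_on_def
      equivalent_norm_def monotone_norm_def
    by (auto simp: cone_le_def)
  obtain \<epsilon> v w where \<epsilon>: "\<And>n. \<epsilon> n > 0" "\<epsilon> \<longlonglongrightarrow> 0"
    and eig: "\<And>n. is_eigenvector_in (interior C) (f_approx f p u (\<epsilon> n)) (v n)"
    and pv: "\<And>n. p (v n) = 1" and v: "v \<longlonglongrightarrow> w"
    using assms(13) unfolding converging_approx_eigenvectors_def convergent_def by blast
  have "\<forall>n. \<exists>s. f_approx f p u (\<epsilon> n) (v n) = s *\<^sub>R v n"
    using eig unfolding is_eigenvector_in_def by blast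
  then obtain r where r: "\<And>n. f_approx f p u (\<epsilon> n) (v n) = r n *\<^sub>R v n" by metis
  have pair: "perturbed_eigenpair (\<epsilon> n) (r n) (v n)" for n
    using \<epsilon>(1)[of n] eig[of n] pv[of n] r[of n]
    unfolding perturbed_eigenpair_def is_eigenvector_in_def f_approx_def by simp
  have "w \<noteq> 0"
  proof
    assume "w = 0"
    obtain d where d: "\<And>x. p x \<le> d * norm x" using assms(9) unfolding equivalent_norm_def by blast
    have "(\<lambda>n. d * norm (v n)) \<longlonglongrightarrow> d * norm w" by (intro tendsto_intros v)
    moreover have "1 \<le> d * norm (v n)" for n using d[of "v n"] pv by simp
    ultimately have "1 \<le> d * norm w" by (intro LIMSEQ_le_const) auto
    then show False using \<open>w = 0\<close> by simp
  qed
  obtain \<rho> and \<sigma> :: "nat \<Rightarrow> nat" where \<rho>: "\<rho> > 0" "strict_mono \<sigma>" "(\<lambda>n. r (\<sigma> n)) \<longlonglongrightarrow> \<rho>"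
    using convergent_eigenvalue_subsequence[OF pair \<epsilon>(2)] by blast
  interpret approximate_eigenvectors C f p u "\<lambda>n. \<epsilon> (\<sigma> n)" "\<lambda>n. r (\<sigma> n)" "\<lambda>n. v (\<sigma> n)" w \<rho>
    using pair \<rho> \<open>w \<noteq> 0\<close> LIMSEQ_subseq_LIMSEQ[OF \<epsilon>(2) \<rho>(2)] LIMSEQ_subseq_LIMSEQ[OF v \<rho>(2)]
    by unfold_locales (auto simp: o_def)
  let ?h = "i_R C b w"
  have "?h \<in> A_R C b" by (rule i_R_mem_A_R[OF assms(8) w_mem])
  moreover have "ereal (escape_rate C f) = (INF x\<in>interior C. ereal (?h x - ?h (f x)))"
    using INF_i_R_limit[OF assms(8)] by simp
  moreover have "\<forall>h\<in>A_R C b. (INF x\<in>interior C. ereal (h x - h (f x))) \<le> ereal (escape_rate C f)"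
    using INF_le_escape_rate unfolding A_R_def by blast
  moreover have "?h \<in> horofunctions_R C b" if "\<nexists>v. is_eigenvector_in (interior C) f v"
    using i_R_limit_horofunction[OF assms(8) that] .
  ultimately show ?thesis by blast
qed

end
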